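(* Let $k$ be an arbitrary field. Then: (1) There exists a bijection $\mathcal{AH}^2_k(k,k)\cong (k\times k)/\equiv$, where $\equiv$ is the equivalence relation on $k\times k$ defined by: $(a,b)\equiv(a',b')$ if and only if there exists a pair $(q,\alpha)\in k^*\times k$ such that $$a=q^2a'+\alpha^2-b\,\alpha,\qquad b=q\,b'+2\alpha.$$ The bijection between $(k\times k)/\equiv$ and the isomorphism classes of all $2$-dimensional unital associative $k$-algebras is given by $\overline{(a,b)}\mapsto k_{(a,b)}$, where $k_{(a,b)}$ is the algebra having $\{1,x\}$ as a basis and multiplication $x^2=a+bx$. (2) If $\mathrm{char}(k)\neq2$ and $k=k^2$, then $(k\times k)/\equiv$ equals $\{\overline{(0,0)},\overline{(0,1)}\}$. Thus there exist exactly two isomorphism types of $2$-dimensional algebras, namely $k_{(0,0)}$ and $k_{(0,1)}\cong k\times k$. (3) If $\mathrm{char}(k)\neq2$ and $k\neq k^2$, then $(k\times k)/\equiv$ equals $\{\overline{(0,0)},\overline{(0,1)}\}\cup\{\overline{(d,0)}\mid d\in S\}$. Thus there exist $1+[k^*:(k^2)^*]$ isomorphism types of $2$-dimensional algebras, namely $k_{(0,0)}$, $k_{(0,1)}$ and $k_{(d,0)}$ for $d\in S$. (4) If $\mathrm{char}(k)=2$ and $k=k^2$, then $(k\times k)/\equiv$ equals $\{\overline{(0,0)}\}\cup\{\overline{(c,1)}\mid c\in T\}$. Thus there exist $1+|T|$ isomorphism types of $2$-dimensional algebras, namely $k_{(0,0)}$ and $k_{(c,1)}$ for $c\in T$. (5)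 If $\mathrm{char}(k)=2$ and $k\neq k^2$, then $(k\times k)/\equiv$ equals $\{\overline{(0,0)}\}\cup\{\overline{(c,1)}\mid c\in T\}\cup\{\overline{(\delta,0)}\mid\delta\in R\}$. Thus there exist $1+|T|+|R|$ isomorphism types of $2$-dimensional algebras, namely $k_{(0,0)}$, $k_{(c,1)}$ and $k_{(\delta,0)}$ for $c\in T$ and $\delta\in R$.
   Context: "Algebra" means unital associative $k$-algebra. $k^2=\{q^2\mid q\in k\}$, and $[k^*:(k^2)^*]$ is the index of the subgroup $(k^2)^*$ of nonzero squares in $k^*$. If $k\neq k^2$, $S\subseteq k\setminus k^2$ is a system of representatives for the equivalence relation on $k\setminus k^2$: $d\equiv d'$ iff there is $q\in k^*$ with $d=q^2d'$ (so $|S|=[k^*:(k^2)^*]-1$). If $\mathrm{char}(k)=2$ and $k\neq k^2$, $R\subseteq k\setminus k^2$ is a system of representatives for the equivalence relation on $k\setminus k^2$: $\delta\equiv_1\delta'$ iff there is $q\in k^*$ with $\delta-q^2\delta'\in k^2$. If $\mathrm{char}(k)=2$, $T\subseteq k$ is a system of representatives, with $0\in T$, for the equivalence relation on $k$: $c\equiv_2c'$ iff there is $\alpha\in k$ with $c-c'=\alpha^2-\alpha$. $\mathcal{AH}^2_k(k,k)$ is the object $\mathcal{AH}^2_A(V,A)$ for $A=k$, $V=k$, defined as follows. An algebra extending structure of $A$ through $V$ is a system $(\triangleleft,\triangleright,\leftharpoonup,\rightharpoonup,f,\cdot)$ of bilinear maps $\triangleleft:V\times A\to V$, $\triangleright:V\times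 A\to A$, $\leftharpoonup:A\times V\to A$, $\rightharpoonup:A\times V\to V$, $f:V\times V\to A$, $\cdot:V\times V\to V$ such that $(a,x)\bullet(b,y)=(ab+a\leftharpoonup y+x\triangleright b+f(x,y),\ a\rightharpoonup y+x\triangleleft b+x\cdot y)$ is associative on $A\times V$ with unit $(1_A,0)$. $\mathcal{AH}^2_A(V,A)$ is the quotient of the set of all these by the equivalence relation: $(\triangleleft,\ldots,\cdot)\equiv(\triangleleft',\ldots,\cdot')$ iff there exist a linear map $r:V\to A$ and a linear automorphism $v$ of $V$ such that, with $w=v^{-1}$, for all $a\in A$, $x,y\in V$: $a\rightharpoonup' x=v(a\rightharpoonup w(x))$; $a\leftharpoonup' x=r(a\rightharpoonup w(x))-a\,r(w(x))+a\leftharpoonup w(x)$; $x\triangleleft' a=v(w(x)\triangleleft a)$; $x\triangleright' a=r(w(x)\triangleleft a)-r(w(x))a+w(x)\triangleright a$; $x\cdot' y=v(w(x)\cdot w(y))-v(r(w(x))\rightharpoonup w(y))-v(w(x)\triangleleft r(w(y)))$; $f'(x,y)=r(w(x)\cdot w(y))+f(w(x),w(y))-r(r(w(x))\rightharpoonup w(y))-r(w(x))\leftharpoonup w(y)-r(w(x)\triangleleft r(w(y)))+r(w(x))r(w(y))-w(x)\triangleright r(w(y))$. *)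

theory Defs
  imports
    Complex_Main
    "HOL-Library.Equipollence"
    "HOL-Library.Product_Plus"
    "HOL-Algebra.Coset"
begin

text \<open>
  The ground field is a type \<open>'k::field\<close>. Vector spaces over it are types of class
  \<open>ab_group_add\<close> with a scalar multiplication satisfying the library locale \<open>vector_space\<close>;
  since several algebra structures live on one type, multiplication and unit are explicit.
\<close>

definition bilinear_map ::
  "('k::field \<Rightarrow> 'a \<Rightarrow> 'a) \<Rightarrow> ('k \<Rightarrow> 'b \<Rightarrow> 'b) \<Rightarrow> ('k \<Rightarrow> 'c \<Rightarrow> 'c)
    \<Rightarrow> ('a::ab_group_add \<Rightarrow> 'b::ab_group_add \<Rightarrow> 'c::ab_group_add) \<Rightarrow> bool" where
  "bilinear_map s1 s2 s3 f \<longleftrightarrow>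
     (\<forall>x. Vector_Spaces.linear s2 s3 (\<lambda>y. f x y)) \<and>
     (\<forall>y. Vector_Spaces.linear s1 s3 (\<lambda>x. f x y))"

record ('k, 'a) alg =
  scl :: "'k \<Rightarrow> 'a \<Rightarrow> 'a"
  mul :: "'a \<Rightarrow> 'a \<Rightarrow> 'a"
  unt :: 'a

definition is_algebra :: "('k::field, 'a::ab_group_add) alg \<Rightarrow> bool" where
  "is_algebra A \<longleftrightarrow>
     vector_space (scl A) \<and> bilinear_map (scl A) (scl A) (scl A) (mul A) \<and>
     Groups.monoid (mul A) (unt A)"

definition alg_iso ::
  "('k::field, 'a::ab_group_add) alg \<Rightarrow> ('k, 'b::ab_group_add) alg \<Rightarrow> ('a \<Rightarrow> 'b) \<Rightarrow> bool" where
  "alg_iso A B \<phi> \<longleftrightarrow>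
     Vector_Spaces.linear (scl A) (scl B) \<phi> \<and> bij \<phi> \<and>
     (\<forall>x y. \<phi> (mul A x y) = mul B (\<phi> x) (\<phi> y)) \<and> \<phi> (unt A) = unt B"

definition isomorphic ::
  "('k::field, 'a::ab_group_add) alg \<Rightarrow> ('k, 'b::ab_group_add) alg \<Rightarrow> bool"
  (infix \<open>\<cong>\<^sub>a\<close> 50) where
  "A \<cong>\<^sub>a B \<longleftrightarrow> (\<exists>\<phi>. alg_iso A B \<phi>)"

definition two_dim_algs :: "('k::field, 'a::ab_group_add) alg set" where
  "two_dim_algs = {A. is_algebra A \<and> vector_space.dim (scl A) UNIV = 2}"

definition alg_iso_rel ::
  "(('k::field, 'a::ab_group_add) alg \<times> ('k, 'a) alg) set" where
  "alg_iso_rel = {(A, B). A \<in> two_dim_algs \<and> B \<in> two_dim_algs \<and> A \<cong>\<^sub>a B}"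

text \<open>
  A two-dimensional algebra has an underlying vector space isomorphic to \<open>k \<times> k\<close>, so isomorphism
  classes are collected on that type, with arbitrary scalar multiplication, product and unit.
\<close>

definition iso_types :: "('k::field, 'k \<times> 'k) alg set set" where
  "iso_types = two_dim_algs // alg_iso_rel"

definition iso_type :: "('k::field, 'k \<times> 'k) alg \<Rightarrow> ('k, 'k \<times> 'k) alg set" where
  "iso_type A = alg_iso_rel `` {A}"

definition pair_scale :: "'k::field \<Rightarrow> 'k \<times> 'k \<Rightarrow> 'k \<times> 'k" where
  "pair_scale c p = (c * fst p, c * snd p)"

text \<open>The pair \<open>(s, t)\<close> stands for \<open>s + t x\<close>, so \<open>x = (0, 1)\<close>; the product is forced by
  \<open>x\<^sup>2 = a + b x\<close>.\<close>

definition k_alg :: "'k::field \<Rightarrow> 'k \<Rightarrow> ('k, 'k \<times> 'k) alg" where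
  "k_alg a b =
     \<lparr>scl = pair_scale,
      mul = (\<lambda>(s, t) (s', t'). (s * s' + t * t' * a, s * t' + t * s' + t * t' * b)),
      unt = (1, 0)\<rparr>"

lemma vector_space_pair_scale: "vector_space (pair_scale :: 'k::field \<Rightarrow> _)"
  by unfold_locales (auto simp: pair_scale_def algebra_simps)

lemma k_alg_basis:
  fixes a b :: "'k::field"
  shows "\<not> module.dependent (scl (k_alg a b)) {(1, 0), (0, 1)}"
    and "module.span (scl (k_alg a b)) {(1, 0), (0, 1)} = UNIV"
proof -
  interpret vector_space "pair_scale :: 'k \<Rightarrow> _" by (rule vector_space_pair_scale)
  have "independent {(1, 0), (0, 1) :: 'k \<times> 'k}"
    by (simp add: independent_insert span_singleton pair_scale_def image_iff zero_prod_def)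
  then show "\<not> module.dependent (scl (k_alg a b)) {(1, 0), (0, 1)}"
    by (simp add: k_alg_def)
  have "p \<in> span {(1, 0), (0, 1)}" for p :: "'k \<times> 'k"
  proof -
    have "pair_scale (fst p) (1, 0) + pair_scale (snd p) (0, 1) \<in> span {(1, 0), (0, 1) :: 'k \<times> 'k}"
      by (intro span_add span_scale span_base) auto
    then show ?thesis by (simp add: pair_scale_def)
  qed
  then show "module.span (scl (k_alg a b)) {(1, 0), (0, 1)} = UNIV"
    by (auto simp: k_alg_def)
qed

lemma k_alg_relation:
  "mul (k_alg a b) (0, 1) (0, 1)
     = scl (k_alg a b) a (unt (k_alg a b)) + scl (k_alg a b) b (0, 1)"
  by (simp add: k_alg_def pair_scale_def)

lemma k_alg_two_dim: "k_alg a b \<in> two_dim_algs"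
proof -
  interpret vector_space "pair_scale :: 'a \<Rightarrow> _" by (rule vector_space_pair_scale)
  have "dim (UNIV :: ('a \<times> 'a) set) = card {(1, 0), (0, 1) :: 'a \<times> 'a}"
    using k_alg_basis[of a b]
    by (intro dim_unique) (auto simp: k_alg_def)
  moreover have "bilinear_map pair_scale pair_scale pair_scale (mul (k_alg a b))"
    by (simp add: bilinear_map_def Vector_Spaces.linear_iff vector_space_pair_scale k_alg_def
        pair_scale_def algebra_simps)
  moreover have "Groups.monoid (mul (k_alg a b)) (unt (k_alg a b))"
    by unfold_locales (auto simp: k_alg_def algebra_simps)
  ultimately show ?thesis
    using vector_space_pair_scale
    by (simp add: two_dim_algs_def is_algebra_def) (simp add: k_alg_def)
qed

definition prod_alg :: "('k::field, 'k \<times> 'k) alg" where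
  "prod_alg =
     \<lparr>scl = pair_scale, mul = (\<lambda>(s, t) (s', t'). (s * s', t * t')), unt = (1, 1)\<rparr>"

definition field_alg :: "('k::field, 'k) alg" where
  "field_alg = \<lparr>scl = (*), mul = (*), unt = 1\<rparr>"

record ('a, 'v) ext_struct =
  tri_l :: "'v \<Rightarrow> 'a \<Rightarrow> 'v"  (* \<triangleleft> *)
  tri_r :: "'v \<Rightarrow> 'a \<Rightarrow> 'a"  (* \<triangleright> *)
  harp_l :: "'a \<Rightarrow> 'v \<Rightarrow> 'a"  (* \<leftharpoonup> *)
  harp_r :: "'a \<Rightarrow> 'v \<Rightarrow> 'v"  (* \<rightharpoonup> *)
  cocyc :: "'v \<Rightarrow> 'v \<Rightarrow> 'a"  (* f *)
  vmul :: "'v \<Rightarrow> 'v \<Rightarrow> 'v"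

definition ext_mul ::
  "('k::field, 'a::ab_group_add) alg \<Rightarrow> ('a, 'v::ab_group_add) ext_struct
    \<Rightarrow> 'a \<times> 'v \<Rightarrow> 'a \<times> 'v \<Rightarrow> 'a \<times> 'v" where
  "ext_mul A \<Omega> = (\<lambda>(a, x) (b, y).
     (mul A a b + harp_l \<Omega> a y + tri_r \<Omega> x b + cocyc \<Omega> x y,
      harp_r \<Omega> a y + tri_l \<Omega> x b + vmul \<Omega> x y))"

definition ext_structs ::
  "('k::field, 'a::ab_group_add) alg \<Rightarrow> ('k \<Rightarrow> 'v \<Rightarrow> 'v)
    \<Rightarrow> ('a, 'v::ab_group_add) ext_struct set" where
  "ext_structs A sV = {\<Omega>.
     bilinear_map sV (scl A) sV (tri_l \<Omega>) \<and>
     bilinear_map sV (scl A) (scl A) (tri_r \<Omega>) \<and>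
     bilinear_map (scl A) sV (scl A) (harp_l \<Omega>) \<and>
     bilinear_map (scl A) sV sV (harp_r \<Omega>) \<and>
     bilinear_map sV sV (scl A) (cocyc \<Omega>) \<and>
     bilinear_map sV sV sV (vmul \<Omega>) \<and>
     Groups.monoid (ext_mul A \<Omega>) (unt A, 0)}"

definition ext_equiv ::
  "('k::field, 'a::ab_group_add) alg \<Rightarrow> ('k \<Rightarrow> 'v \<Rightarrow> 'v)
    \<Rightarrow> (('a, 'v::ab_group_add) ext_struct \<times> ('a, 'v) ext_struct) set" where
  "ext_equiv A sV = {(\<Omega>, \<Omega>').
     \<Omega> \<in> ext_structs A sV \<and> \<Omega>' \<in> ext_structs A sV \<and>
     (\<exists>r v. Vector_Spaces.linear sV (scl A) r \<and> Vector_Spaces.linear sV sV v \<and> bij v \<and>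
       (let w = inv_into UNIV v in \<forall>a x y.
          harp_r \<Omega>' a x = v (harp_r \<Omega> a (w x)) \<and>
          harp_l \<Omega>' a x = r (harp_r \<Omega> a (w x)) - mul A a (r (w x)) + harp_l \<Omega> a (w x) \<and>
          tri_l \<Omega>' x a = v (tri_l \<Omega> (w x) a) \<and>
          tri_r \<Omega>' x a = r (tri_l \<Omega> (w x) a) - mul A (r (w x)) a + tri_r \<Omega> (w x) a \<and>
          vmul \<Omega>' x y =
            v (vmul \<Omega> (w x) (w y)) - v (harp_r \<Omega> (r (w x)) (w y))
              - v (tri_l \<Omega> (w x) (r (w y))) \<and>
          cocyc \<Omega>' x y =
            r (vmul \<Omega> (w x) (w y)) + cocyc \<Omega> (w x) (w y)
              - r (harp_r \<Omega> (r (w x)) (w y)) - harp_l \<Omega> (r (w x)) (w y)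
              - r (tri_l \<Omega> (w x) (r (w y))) + mul A (r (w x)) (r (w y))
              - tri_r \<Omega> (w x) (r (w y))))}"

definition AH2 ::
  "('k::field, 'a::ab_group_add) alg \<Rightarrow> ('k \<Rightarrow> 'v \<Rightarrow> 'v)
    \<Rightarrow> ('a, 'v::ab_group_add) ext_struct set set" where
  "AH2 A sV = ext_structs A sV // ext_equiv A sV"

definition pair_equiv :: "(('k::field \<times> 'k) \<times> ('k \<times> 'k)) set" where
  "pair_equiv = {((a, b), (a', b')).
     \<exists>q \<alpha>. q \<noteq> 0 \<and> a = q\<^sup>2 * a' + \<alpha>\<^sup>2 - b * \<alpha> \<and> b = q * b' + 2 * \<alpha>}"

definition pair_classes :: "('k::field \<times> 'k) set set" where
  "pair_classes = UNIV // pair_equiv"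

definition pair_class :: "'k::field \<Rightarrow> 'k \<Rightarrow> ('k \<times> 'k) set" where
  "pair_class a b = pair_equiv `` {(a, b)}"

definition squares :: "'k::field set" where
  "squares = {q\<^sup>2 | q. True}"

definition mult_group :: "'k::field monoid" where
  "mult_group = \<lparr>carrier = UNIV - {0}, mult = (*), one = 1\<rparr>"

text \<open>The coset space \<open>k\<^sup>*/(k\<^sup>2)\<^sup>*\<close>, whose cardinality is the index \<open>[k\<^sup>* : (k\<^sup>2)\<^sup>*]\<close>; it is kept as a
  set because the index may be infinite.\<close>

definition square_cosets :: "'k::field set set" where
  "square_cosets = rcosets\<^bsub>mult_group\<^esub> (squares - {0})"

definition system_of_reps :: "'a set \<Rightarrow> ('a \<Rightarrow> 'a \<Rightarrow> bool) \<Rightarrow> 'a set \<Rightarrow> bool" where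
  "system_of_reps X E Y \<longleftrightarrow> Y \<subseteq> X \<and> (\<forall>x\<in>X. \<exists>!y. y \<in> Y \<and> E x y)"

definition S_equiv :: "'k::field \<Rightarrow> 'k \<Rightarrow> bool" where
  "S_equiv d d' \<longleftrightarrow> (\<exists>q. q \<noteq> 0 \<and> d = q\<^sup>2 * d')"

definition R_equiv :: "'k::field \<Rightarrow> 'k \<Rightarrow> bool" where
  "R_equiv \<delta> \<delta>' \<longleftrightarrow> (\<exists>q. q \<noteq> 0 \<and> \<delta> - q\<^sup>2 * \<delta>' \<in> squares)"

definition T_equiv :: "'k::field \<Rightarrow> 'k \<Rightarrow> bool" where
  "T_equiv c c' \<longleftrightarrow> (\<exists>\<alpha>. c - c' = \<alpha>\<^sup>2 - \<alpha>)"

end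

theory Submission
  imports Defs
begin

text \<open>
  A unital structure on \<open>k \<times> k\<close> extending \<open>k\<close>, or a two-dimensional algebra with a basis \<open>{1, x}\<close>, is
  determined by \<open>x\<^sup>2 = a + b x\<close>; replacing \<open>x\<close> by \<open>\<alpha> + q x\<close> acts on \<open>(a, b)\<close> by the stated equivalence
  in both cases. If the characteristic is not 2, completing the square shows that the discriminant
  \<open>b\<^sup>2 + 4 a\<close> modulo nonzero squares is a complete invariant. In characteristic 2, \<open>b = 0\<close> is invariant;
  pairs with \<open>b \<noteq> 0\<close> are classified by \<open>a / b\<^sup>2\<close> modulo \<open>\<alpha>\<^sup>2 - \<alpha>\<close>, and pairs \<open>(a, 0)\<close> by \<open>\<equiv>\<^sub>1\<close>.
\<close>

section \<open>Bijections between quotients\<close>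

text \<open>Preservation of the relation by \<open>f\<close> makes the induced map on classes well
  defined, reflection makes it injective, and \<open>surj\<close> makes it onto. With
  \<open>k_alg\<close> and \<open>k_ext\<close> in place of \<open>f\<close>, isomorphism types and
  extending structures are both compared with pairs.\<close>

lemma bij_betw_quotients:
  assumes e: "equiv A e" and e': "equiv B e'"
    and f: "\<And>x. x \<in> A \<Longrightarrow> f x \<in> B"
    and iff: "\<And>x y. x \<in> A \<Longrightarrow> y \<in> A \<Longrightarrow> (f x, f y) \<in> e' \<longleftrightarrow> (x, y) \<in> e"
    and surj: "\<And>z. z \<in> B \<Longrightarrow> \<exists>x\<in>A. (z, f x) \<in> e'"
  shows "\<exists>F. bij_betw F (A // e) (B // e') \<and> (\<forall>x\<in>A. F (e `` {x}) = e' `` {f x})"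
proof -
  \<comment> \<open>When \<open>X\<close> is a class, the sets united here all coincide, so no
    representative has to be chosen.\<close>
  define F where "F X = (\<Union>x\<in>X. e' `` {f x})" for X
  have "congruent e (\<lambda>x. e' `` {f x})"
    using e iff by (intro congruentI equiv_class_eq[OF e']) (auto simp: equiv_def)
  then have F: "F (e `` {x}) = e' `` {f x}" if "x \<in> A" for x
    unfolding F_def using UN_equiv_class[OF e _ that] by blast
  have "inj_on F (A // e)"
  proof (rule inj_onI, elim quotientE)
    fix X Y x y
    assume "F X = F Y" and *: "x \<in> A" "X = e `` {x}" "y \<in> A" "Y = e `` {y}"
    then have "e' `` {f x} = e' `` {f y}" by (simp add: F)
    then have "(x, y) \<in> e" using * f iff eq_equiv_class_iff[OF e'] by blast
    then show "X = Y" using * equiv_class_eq[OF e] by simp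
  qed
  moreover have "F ` (A // e) = B // e'"
  proof (intro equalityI subsetI)
    fix Z assume "Z \<in> F ` (A // e)"
    then show "Z \<in> B // e'" by (auto elim!: quotientE simp: F f intro!: quotientI)
  next
    fix Z assume "Z \<in> B // e'"
    then obtain z where z: "z \<in> B" "Z = e' `` {z}" by (rule quotientE)
    then obtain x where x: "x \<in> A" "(z, f x) \<in> e'" using surj by blast
    then have "Z = F (e `` {x})" using z equiv_class_eq[OF e'] by (simp add: F)
    then show "Z \<in> F ` (A // e)" using x by (auto intro: quotientI)
  qed
  ultimately show ?thesis using F by (intro exI[of _ F]) (simp add: bij_betw_def)
qed

text \<open>Uniqueness of the representative gives injectivity and existence gives surjectivity, so
  a list of representatives also counts the classes.\<close>

lemma system_of_reps_bij_betw_quotient: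
  assumes e: "equiv A e" and P: "system_of_reps A (\<lambda>x y. (x, y) \<in> e) P"
  shows "bij_betw (\<lambda>x. e `` {x}) P (A // e)"
proof (rule bij_betw_imageI)
  have PA: "P \<subseteq> A" and ex1: "\<And>x. x \<in> A \<Longrightarrow> \<exists>!y. y \<in> P \<and> (x, y) \<in> e"
    using P by (auto simp: system_of_reps_def)
  show "inj_on (\<lambda>x. e `` {x}) P"
  proof (rule inj_onI)
    fix x y assume xy: "x \<in> P" "y \<in> P" "e `` {x} = e `` {y}"
    then have "(x, y) \<in> e" "(x, x) \<in> e" using PA eq_equiv_class_iff[OF e] by blast+
    then show "x = y" using ex1 PA xy by blast
  qed
  show "(\<lambda>x. e `` {x}) ` P = A // e"
  proof (intro equalityI subsetI)
    fix Z assume "Z \<in> A // e"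
    then obtain x where x: "x \<in> A" "Z = e `` {x}" by (rule quotientE)
    then obtain y where "y \<in> P" "(x, y) \<in> e" using ex1 by blast
    then show "Z \<in> (\<lambda>x. e `` {x}) ` P" using x equiv_class_eq[OF e] by blast
  qed (use PA in \<open>auto intro: quotientI\<close>)
qed

section \<open>Isomorphism of algebras\<close>

lemma isomorphic_refl:
  assumes "is_algebra A" shows "A \<cong>\<^sub>a A"
proof -
  have "alg_iso A A (\<lambda>x. x)"
    using assms by (simp add: alg_iso_def is_algebra_def Vector_Spaces.linear_iff bij_id[unfolded id_def])
  then show ?thesis by (auto simp: isomorphic_def)
qed

lemma isomorphic_sym:
  assumes "A \<cong>\<^sub>a B" shows "B \<cong>\<^sub>a A"
proof -
  obtain \<phi> where \<phi>: "alg_iso A B \<phi>" using assms by (auto simp: isomorphic_def)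
  then have lin: "Vector_Spaces.linear (scl A) (scl B) \<phi>" and bij: "bij \<phi>"
    and m: "\<And>x y. \<phi> (mul A x y) = mul B (\<phi> x) (\<phi> y)" and u: "\<phi> (unt A) = unt B"
    by (auto simp: alg_iso_def)
  let ?\<psi> = "inv_into UNIV \<phi>"
  have [simp]: "\<phi> (?\<psi> y) = y" for y using bij by (simp add: bij_is_surj surj_f_inv_f)
  have inj: "\<phi> x = \<phi> y \<longleftrightarrow> x = y" for x y using bij by (simp add: bij_is_inj inj_eq)
  \<comment> \<open>Each law for the inverse is checked after applying the injective map \<phi> to
    both sides.\<close>
  have "?\<psi> (x + y) = ?\<psi> x + ?\<psi> y" "?\<psi> (scl B c x) = scl A c (?\<psi> x)"
    "?\<psi> (mul B x y) = mul A (?\<psi> x) (?\<psi> y)" "?\<psi> (unt B) = unt A" for x y c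
    using lin unfolding inj[symmetric] by (simp_all add: m u Vector_Spaces.linear_iff)
  then have "alg_iso B A ?\<psi>"
    using lin bij by (simp add: alg_iso_def Vector_Spaces.linear_iff bij_imp_bij_inv)
  then show ?thesis by (auto simp: isomorphic_def)
qed

lemma isomorphic_trans:
  assumes "A \<cong>\<^sub>a B" "B \<cong>\<^sub>a C" shows "A \<cong>\<^sub>a C"
proof -
  obtain \<phi> \<psi> where "alg_iso A B \<phi>" "alg_iso B C \<psi>" using assms by (auto simp: isomorphic_def)
  then have "alg_iso A C (\<lambda>x. \<psi> (\<phi> x))"
    by (auto simp: alg_iso_def Vector_Spaces.linear_iff intro: bij_comp[unfolded comp_def])
  then show ?thesis by (auto simp: isomorphic_def)
qed

lemma equiv_alg_iso_rel: "equiv two_dim_algs alg_iso_rel"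
  by (auto simp: alg_iso_rel_def two_dim_algs_def intro!: equivI refl_onI symI transI
      intro: isomorphic_refl isomorphic_sym isomorphic_trans)

section \<open>The algebras \<open>k_alg a b\<close> up to isomorphism\<close>

lemma scl_k_alg: "scl (k_alg a b) = pair_scale" and unt_k_alg: "unt (k_alg a b) = (1, 0)"
  by (simp_all add: k_alg_def)

text \<open>A unital linear map is determined by the image \<alpha> + q x' of the basis vector x. It
  is bijective exactly when q is nonzero, and multiplicative exactly when the images of x^2 agree;
  the two coordinates of that condition are the equations of \<open>pair_equiv\<close>.\<close>

lemma k_alg_isomorphic_iff:
  "k_alg a b \<cong>\<^sub>a k_alg a' b' \<longleftrightarrow> ((a, b), (a', b')) \<in> pair_equiv" for a b a' b' :: "'k::field"
proof
  assume "k_alg a b \<cong>\<^sub>a k_alg a' b'"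
  then obtain \<phi> where iso: "alg_iso (k_alg a b) (k_alg a' b') \<phi>" by (auto simp: isomorphic_def)
  then have bij: "bij \<phi>" and add: "\<And>x y. \<phi> (x + y) = \<phi> x + \<phi> y"
    and sc: "\<And>c x. \<phi> (pair_scale c x) = pair_scale c (\<phi> x)"
    and m: "\<And>x y. \<phi> (mul (k_alg a b) x y) = mul (k_alg a' b') (\<phi> x) (\<phi> y)"
    and u: "\<phi> (1, 0) = (1, 0)"
    unfolding alg_iso_def Vector_Spaces.linear_iff scl_k_alg unt_k_alg by blast+
  obtain \<alpha> q where x: "\<phi> (0, 1) = (\<alpha>, q)" by force
  have \<phi>: "\<phi> (s, t) = (s + t * \<alpha>, t * q)" for s t
    using add[of "pair_scale s (1, 0)" "pair_scale t (0, 1)"]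
    by (simp add: sc u x) (simp add: pair_scale_def)
  \<comment> \<open>If q were 0, the scalar \<alpha> and x would have the same image.\<close>
  have "q \<noteq> 0"
  proof
    assume "q = 0"
    then have "\<phi> (\<alpha>, 0) = \<phi> (0, 1)" by (simp add: \<phi>)
    then show False using bij by (simp add: bij_is_inj inj_eq)
  qed
  \<comment> \<open>The two sides are \<phi>(x^2) and \<phi>(x)^2; a factor q remains in the second
    coordinate and is cancelled at the end.\<close>
  moreover have "(a + b * \<alpha>, b * q) = (\<alpha> * \<alpha> + q * q * a', \<alpha> * q + q * \<alpha> + q * q * b')"
    using m[of "(0, 1)" "(0, 1)"] by (simp add: k_alg_def \<phi>)
  ultimately have "a = q\<^sup>2 * a' + \<alpha>\<^sup>2 - b * \<alpha>" "b * q = (q * b' + 2 * \<alpha>) * q"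
    by (auto simp: power2_eq_square algebra_simps)
  then show "((a, b), (a', b')) \<in> pair_equiv"
    using \<open>q \<noteq> 0\<close> by (auto simp: pair_equiv_def)
next
  assume "((a, b), (a', b')) \<in> pair_equiv"
  then obtain q \<alpha> where q: "q \<noteq> 0" and a: "a = q\<^sup>2 * a' + \<alpha>\<^sup>2 - b * \<alpha>" and b: "b = q * b' + 2 * \<alpha>"
    by (auto simp: pair_equiv_def)
  define \<phi> where "\<phi> p = (fst p + snd p * \<alpha>, snd p * q)" for p
  have "bij \<phi>"
    by (rule bij_betw_byWitness[where f' = "\<lambda>p. (fst p - snd p / q * \<alpha>, snd p / q)"])
      (auto simp: \<phi>_def q)
  moreover have "\<phi> (mul (k_alg a b) x y) = mul (k_alg a' b') (\<phi> x) (\<phi> y)" for x y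
    by (cases x; cases y) (simp add: k_alg_def \<phi>_def a b algebra_simps power2_eq_square)
  ultimately have "alg_iso (k_alg a b) (k_alg a' b') \<phi>"
    unfolding alg_iso_def
    by (auto simp: Vector_Spaces.linear_iff \<phi>_def k_alg_def vector_space_pair_scale[unfolded pair_scale_def[abs_def]]
        pair_scale_def[abs_def] algebra_simps)
  then show "k_alg a b \<cong>\<^sub>a k_alg a' b'" by (auto simp: isomorphic_def)
qed

text \<open>The relation is isomorphism of the algebras \<open>k_alg a b\<close>, so the equivalence
  laws are inherited without computing with q and \<alpha>.\<close>

lemma equiv_pair_equiv: "equiv UNIV (pair_equiv :: (('k::field \<times> 'k) \<times> ('k \<times> 'k)) set)"
proof -
  have "k_alg (fst x) (snd x) \<cong>\<^sub>a k_alg (fst x) (snd x)" for x :: "'k \<times> 'k"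
    using k_alg_two_dim by (intro isomorphic_refl) (auto simp: two_dim_algs_def)
  moreover have "(x, y) \<in> pair_equiv \<longleftrightarrow> k_alg (fst x) (snd x) \<cong>\<^sub>a k_alg (fst y) (snd y)"
    for x y :: "'k \<times> 'k"
    by (simp only: k_alg_isomorphic_iff prod.collapse)
  ultimately show ?thesis
    by (auto intro!: equivI refl_onI symI transI intro: isomorphic_sym isomorphic_trans)
qed

text \<open>The unit is nonzero and extends to a basis {1, x}. By bilinearity and the unit laws, the
  whole product is then determined by the coordinates of x^2.\<close>

lemma two_dim_alg_isomorphic_k_alg:
  fixes A :: "('k::field, 'a::ab_group_add) alg"
  assumes "A \<in> two_dim_algs"
  shows "\<exists>a b. A \<cong>\<^sub>a k_alg a b"
proof -
  interpret vector_space "scl A" using assms by (simp add: two_dim_algs_def is_algebra_def)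
  have dim: "dim UNIV = 2" and bil: "bilinear_map (scl A) (scl A) (scl A) (mul A)"
    and mon: "Groups.monoid (mul A) (unt A)"
    using assms by (auto simp: two_dim_algs_def is_algebra_def)
  interpret M: Groups.monoid "mul A" "unt A" by (rule mon)
  have ml: "mul A (x + y) z = mul A x z + mul A y z" "mul A (scl A c x) z = scl A c (mul A x z)"
    and mr: "mul A z (x + y) = mul A z x + mul A z y" "mul A z (scl A c x) = scl A c (mul A z x)"
    for x y z c
    using bil by (simp_all add: bilinear_map_def Vector_Spaces.linear_iff)
  \<comment> \<open>With 1 = 0 every x = 1 x vanishes, so the dimension would be 0 instead of
    2.\<close>
  have "unt A \<noteq> 0"
  proof
    assume 0: "unt A = 0"
    have "x = 0" for x :: 'a
      using M.left_neutral[of x] ml(2)[of 0 0 x] by (simp add: 0)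
    then have "UNIV = {0 :: 'a}" by auto
    then have "dim UNIV = dim {0}" by simp
    then show False
      using dim dim_eq_card_independent[OF independent_empty] span_empty dim_span[of "{}"] by simp
  qed
  then have "independent {unt A}" by simp
  then obtain B where "{unt A} \<subseteq> B" "B \<subseteq> UNIV" "independent B" "UNIV \<subseteq> span B"
    by (rule maximal_independent_subset_extend[OF subset_UNIV])
  then have B: "unt A \<in> B" "independent B" "span B = UNIV" by auto
  then have "card B = 2" using dim_eq_card[of B UNIV] dim by simp
  then have "card (B - {unt A}) = 1" using B(1) by (simp add: card_Diff_singleton)
  then obtain x where "B - {unt A} = {x}" by (rule card_1_singletonE)
  then have x: "B = {unt A, x}" "x \<noteq> unt A" using B(1) by blast+
  define \<phi> where "\<phi> p = scl A (fst p) (unt A) + scl A (snd p) x" for p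
  have surj: "\<exists>p. y = \<phi> p" for y
  proof -
    have "y \<in> span {unt A, x}" using B(3) x by simp
    then obtain s t where "y - scl A s (unt A) = scl A t x"
      by (auto simp: span_insert span_singleton)
    then have "y = \<phi> (s, t)" by (simp add: \<phi>_def algebra_simps)
    then show ?thesis by blast
  qed
  \<comment> \<open>If the coefficient of x were nonzero, x would be a multiple of the unit,
    contrary to independence.\<close>
  have inj: "p = 0" if "\<phi> p = 0" for p
  proof -
    have *: "x \<notin> span {unt A}" using B(2) x by (simp add: insert_commute independent_insert)
    have 1: "scl A (snd p) x = scl A (- fst p) (unt A)"
      using that by (simp add: \<phi>_def add_eq_0_iff)
    have "snd p = 0"
    proof (rule ccontr)
      assume "snd p \<noteq> 0"
      then have "x = scl A (1 / snd p) (scl A (snd p) x)" by simp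
      also have "\<dots> \<in> span {unt A}" unfolding 1 by (intro span_scale span_base) simp
      finally show False using * by simp
    qed
    then show ?thesis using 1 \<open>unt A \<noteq> 0\<close> by (auto simp: prod_eq_iff)
  qed
  \<comment> \<open>The coordinates of x^2 are the parameters a and b sought.\<close>
  obtain p where p: "mul A x x = \<phi> p" using surj by blast
  have add: "\<phi> (p + q) = \<phi> p + \<phi> q" for p q by (simp add: \<phi>_def algebra_simps)
  have sc: "\<phi> (pair_scale c p) = scl A c (\<phi> p)" for p c
    by (simp add: \<phi>_def pair_scale_def algebra_simps)
  have "inj \<phi>"
  proof (rule injI)
    fix p q assume "\<phi> p = \<phi> q"
    then have "\<phi> (p - q) = 0" using add[of "p - q" q] by simp
    then show "p = q" using inj[of "p - q"] by simp
  qed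
  moreover have "surj \<phi>" using surj by blast
  moreover have "\<phi> (mul (k_alg (fst p) (snd p)) y z) = mul A (\<phi> y) (\<phi> z)" for y z
    using p by (cases y; cases z) (simp add: k_alg_def \<phi>_def ml mr algebra_simps)
  ultimately have "alg_iso (k_alg (fst p) (snd p)) A \<phi>"
    unfolding alg_iso_def bij_def
    using add sc vector_space_pair_scale vector_space_axioms
    by (auto simp: Vector_Spaces.linear_iff) (auto simp: k_alg_def \<phi>_def)
  then have "k_alg (fst p) (snd p) \<cong>\<^sub>a A" by (auto simp: isomorphic_def)
  then show ?thesis using isomorphic_sym by blast
qed

section \<open>Extending structures of the ground field\<close>

lemma linear_times_iff:
  "Vector_Spaces.linear (*) (*) f \<longleftrightarrow> (\<exists>c. f = (*) c)" for f :: "'k::field \<Rightarrow> 'k"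
proof
  assume "Vector_Spaces.linear (*) (*) f"
  then have "f (x * 1) = x * f 1" for x unfolding Vector_Spaces.linear_iff by blast
  then have "f = (*) (f 1)" by (metis mult.commute mult_1_right ext)
  then show "\<exists>c. f = (*) c" by blast
next
  assume "\<exists>c. f = (*) c"
  then obtain c where f: "f = (*) c" by blast
  have "vector_space ((*) :: 'k \<Rightarrow> _)" by unfold_locales (auto simp: algebra_simps)
  then show "Vector_Spaces.linear (*) (*) f" by (simp add: Vector_Spaces.linear_iff f algebra_simps)
qed

lemma bilinear_map_times_iff:
  "bilinear_map (*) (*) (*) f \<longleftrightarrow> (\<exists>c. f = (\<lambda>x y. c * x * y))" for f :: "'k::field \<Rightarrow> 'k \<Rightarrow> 'k"
proof
  assume f: "bilinear_map (*) (*) (*) f"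
  then obtain g where g: "\<And>x. f x = (*) (g x)" unfolding bilinear_map_def linear_times_iff by metis
  \<comment> \<open>Setting the second argument to 1 recovers \<open>g\<close>, which is therefore
    itself multiplication by a scalar.\<close>
  obtain c where "(\<lambda>x. f x 1) = (*) c" using f unfolding bilinear_map_def linear_times_iff by blast
  then have "f = (\<lambda>x y. c * x * y)" by (auto simp: g fun_eq_iff)
  then show "\<exists>c. f = (\<lambda>x y. c * x * y)" by blast
next
  assume "\<exists>c. f = (\<lambda>x y. c * x * y)"
  then obtain c where f: "f = (\<lambda>x y. c * x * y)" by blast
  have "f x = (*) (c * x)" "(\<lambda>x. f x y) = (*) (c * y)" for x y
    by (simp_all add: f fun_eq_iff algebra_simps)
  then show "bilinear_map (*) (*) (*) f" unfolding bilinear_map_def linear_times_iff by blast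
qed

text \<open>Unitality of \<open>(1, 0)\<close> fixes the four actions, so only \<open>f\<close> and \<open>\<cdot>\<close> remain free.\<close>

definition k_ext :: "'k::field \<Rightarrow> 'k \<Rightarrow> ('k, 'k) ext_struct" where
  "k_ext a b =
     \<lparr>tri_l = (*), tri_r = (\<lambda>x c. 0), harp_l = (\<lambda>c x. 0), harp_r = (*),
      cocyc = (\<lambda>x y. a * x * y), vmul = (\<lambda>x y. b * x * y)\<rparr>"

text \<open>The product that \<open>k_ext a b\<close> puts on pairs is that of
  \<open>k_alg a b\<close>, hence associative and unital.\<close>

lemma k_ext_in_ext_structs: "k_ext a b \<in> ext_structs field_alg (*)"
proof -
  have "Groups.monoid (ext_mul field_alg (k_ext a b)) (1, 0)"
    by unfold_locales (auto simp: ext_mul_def field_alg_def k_ext_def algebra_simps)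
  moreover have "bilinear_map (*) (*) (*) (\<lambda>x y :: 'a. c * x * y)" for c
    unfolding bilinear_map_times_iff by blast
  from this[of 0] this[of 1] this[of a] this[of b]
  have "bilinear_map (*) (*) (*) (\<lambda>x y :: 'a. 0)" "bilinear_map (*) (*) (*) ((*) :: 'a \<Rightarrow> _)"
    "bilinear_map (*) (*) (*) (\<lambda>x y :: 'a. a * x * y)" "bilinear_map (*) (*) (*) (\<lambda>x y :: 'a. b * x * y)"
    by simp_all
  ultimately show ?thesis by (simp add: ext_structs_def field_alg_def k_ext_def)
qed

lemma ext_structs_field_algE:
  fixes \<Omega> :: "('k::field, 'k) ext_struct"
  assumes "\<Omega> \<in> ext_structs field_alg (*)"
  obtains a b where "\<Omega> = k_ext a b"
proof -
  obtain l r l' r' a b where \<Omega>: "tri_l \<Omega> = (\<lambda>x y. l * x * y)" "tri_r \<Omega> = (\<lambda>x y. r * x * y)"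
    "harp_l \<Omega> = (\<lambda>x y. l' * x * y)" "harp_r \<Omega> = (\<lambda>x y. r' * x * y)"
    "cocyc \<Omega> = (\<lambda>x y. a * x * y)" "vmul \<Omega> = (\<lambda>x y. b * x * y)"
    using assms by (simp add: ext_structs_def field_alg_def) (unfold bilinear_map_times_iff, blast)
  interpret Groups.monoid "ext_mul field_alg \<Omega>" "(1, 0)"
    using assms by (simp add: ext_structs_def field_alg_def)
  \<comment> \<open>The left unit law at (0, 1) yields (l', r') = (0, 1), and the right unit law
    yields (r, l) = (0, 1).\<close>
  have "l' = 0" "r' = 1" "r = 0" "l = 1"
    using left_neutral[of "(0, 1)"] right_neutral[of "(0, 1)"]
    by (simp_all add: ext_mul_def field_alg_def \<Omega>)
  then have "\<Omega> = k_ext a b"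
    using \<Omega> by (intro ext_struct.equality) (auto simp: k_ext_def fun_eq_iff)
  then show thesis using that by blast
qed

text \<open>Linear endomorphisms of the line are multiplications by scalars r and q, with q nonzero
  for the bijective one. The four conditions on the actions then hold automatically, and the two on
  the product and the cocycle become the equations of \<open>pair_equiv\<close> with \<alpha> =
  r.\<close>

lemma k_ext_equiv_iff:
  "(k_ext a b, k_ext a' b') \<in> ext_equiv field_alg (*) \<longleftrightarrow> ((a, b), (a', b')) \<in> pair_equiv"
  for a b a' b' :: "'k::field"
proof -
  \<comment> \<open>what remains of the six conditions when the linear maps are multiplication by \<open>r\<close> and \<open>q\<close>\<close>
  define E where "E r q \<longleftrightarrow> (\<forall>x y.
      b' * x * y = q * (b * (x / q) * (y / q)) - q * (r * (x / q) * (y / q)) - q * (x / q * (r * (y / q))) \<and>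
      a' * x * y = r * (b * (x / q) * (y / q)) + a * (x / q) * (y / q) - r * (r * (x / q) * (y / q))
        - r * (x / q * (r * (y / q))) + r * (x / q) * (r * (y / q)))" for r q
  have E: "E r q \<longleftrightarrow> a = q\<^sup>2 * a' + r\<^sup>2 - b * r \<and> b = q * b' + 2 * r" if "q \<noteq> 0" for r q
  proof
    assume "E r q"
    \<comment> \<open>Both conditions are homogeneous in x and in y, so their instance x = y = 1
      carries all the information.\<close>
    then have "b' = q * (b * (1 / q) * (1 / q)) - q * (r * (1 / q) * (1 / q)) - q * (1 / q * (r * (1 / q)))"
      "a' = r * (b * (1 / q) * (1 / q)) + a * (1 / q) * (1 / q) - r * (r * (1 / q) * (1 / q))
        - r * (1 / q * (r * (1 / q))) + r * (1 / q) * (r * (1 / q))"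
      unfolding E_def by (metis mult_1_right)+
    \<comment> \<open>This relation lets \<open>algebra\<close> treat 1 / q as an
      indeterminate.\<close>
    moreover have "q * (1 / q) = 1" using that by simp
    ultimately have "a = q\<^sup>2 * a' + r\<^sup>2 - b * r" "b = q * b' + 2 * r" by algebra+
    then show "a = q\<^sup>2 * a' + r\<^sup>2 - b * r \<and> b = q * b' + 2 * r" by simp
  next
    assume *: "a = q\<^sup>2 * a' + r\<^sup>2 - b * r \<and> b = q * b' + 2 * r"
    then have a: "a = q\<^sup>2 * a' + r\<^sup>2 - b * r" and b: "b = q * b' + 2 * r" by auto
    show "E r q"
      unfolding E_def a using that by (simp add: b field_simps power2_eq_square)
  qed
  have "(k_ext a b, k_ext a' b') \<in> ext_equiv field_alg (*) \<longleftrightarrow> (\<exists>r q. q \<noteq> 0 \<and> E r q)"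
  proof
    assume "(k_ext a b, k_ext a' b') \<in> ext_equiv field_alg (*)"
    \<comment> \<open>The subtracted zeros are the values of \<open>harp_l\<close> and
      \<open>tri_r\<close>; they are kept so that \<open>eq\<close> matches the unfolded definition
      literally.\<close>
    then obtain r' v' where lin: "Vector_Spaces.linear (*) (*) r'" "Vector_Spaces.linear (*) (*) v'"
      and bij: "bij v'"
      and eq: "\<And>x y. b' * x * y = v' (b * inv_into UNIV v' x * inv_into UNIV v' y)
          - v' (r' (inv_into UNIV v' x) * inv_into UNIV v' y)
          - v' (inv_into UNIV v' x * r' (inv_into UNIV v' y))"
        "\<And>x y. a' * x * y = r' (b * inv_into UNIV v' x * inv_into UNIV v' y)
          + a * inv_into UNIV v' x * inv_into UNIV v' y
          - r' (r' (inv_into UNIV v' x) * inv_into UNIV v' y) - 0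
          - r' (inv_into UNIV v' x * r' (inv_into UNIV v' y))
          + r' (inv_into UNIV v' x) * r' (inv_into UNIV v' y) - 0"
      unfolding ext_equiv_def Let_def field_alg_def k_ext_def
        ext_struct.select_convs alg.select_convs mem_Collect_eq case_prod_conv
      by blast
    obtain r v where r: "r' = (*) r" and v: "v' = (*) v" using lin unfolding linear_times_iff by blast
    have "v \<noteq> 0"
    proof
      assume "v = 0"
      then have "v' 0 = v' 1" by (simp add: v)
      then show False using bij by (simp add: bij_is_inj inj_eq)
    qed
    then have "v' (x / v) = x" for x by (simp add: v)
    then have w: "inv_into UNIV v' x = x / v" for x
      using bij by (metis bij_is_inj inv_f_f)
    \<comment> \<open>The inverse has to be rewritten by \<open>w\<close> while it still mentions
      \<open>v'\<close>; only then are \<open>r'\<close> and \<open>v'\<close> replaced by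
      multiplications.\<close>
    have "E r v"
      unfolding E_def using eq unfolding w diff_zero unfolding r v by blast
    then show "\<exists>r q. q \<noteq> 0 \<and> E r q" using \<open>v \<noteq> 0\<close> by blast
  next
    assume "\<exists>r q. q \<noteq> 0 \<and> E r q"
    then obtain r q where q: "q \<noteq> 0" and E: "E r q" by blast
    have bij: "bij ((*) q)"
      by (rule bij_betw_byWitness[where f' = "\<lambda>x. x / q"]) (auto simp: q)
    have w: "inv_into UNIV ((*) q) x = x / q" for x
      using bij q by (intro inv_f_eq) (auto simp: bij_is_inj)
    have "Vector_Spaces.linear (*) (*) ((*) r)" "Vector_Spaces.linear (*) (*) ((*) q)"
      unfolding linear_times_iff by blast+
    then show "(k_ext a b, k_ext a' b') \<in> ext_equiv field_alg (*)"
      using k_ext_in_ext_structs[of a b] k_ext_in_ext_structs[of a' b'] bij E q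
      unfolding ext_equiv_def Let_def E_def mem_Collect_eq case_prod_conv
      by - (rule conjI, assumption, rule conjI, assumption, rule exI[of _ "(*) r"],
          rule exI[of _ "(*) q"], simp add: k_ext_def field_alg_def w)
  qed
  then show ?thesis using E by (auto simp: pair_equiv_def)
qed

text \<open>Every extending structure is some \<open>k_ext a b\<close>, and on these the relation is
  \<open>pair_equiv\<close>, so its equivalence laws carry over.\<close>

lemma equiv_ext_equiv_field_alg:
  "equiv (ext_structs field_alg (*)) (ext_equiv (field_alg :: ('k::field, 'k) alg) (*))"
proof (rule equivI)
  have eq: "refl (pair_equiv :: (('k \<times> 'k) \<times> ('k \<times> 'k)) set)"
    "sym (pair_equiv :: (('k \<times> 'k) \<times> ('k \<times> 'k)) set)" "trans (pair_equiv :: (('k \<times> 'k) \<times> ('k \<times> 'k)) set)"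
    using equiv_pair_equiv by (auto elim!: equivE)
  show "ext_equiv field_alg (*) \<subseteq> ext_structs field_alg (*) \<times> ext_structs (field_alg :: ('k, 'k) alg) (*)"
    by (auto simp: ext_equiv_def)
  then have *: "\<exists>p q. \<Omega> = case_prod k_ext p \<and> \<Omega>' = case_prod k_ext q \<and> (p, q) \<in> pair_equiv"
    if "(\<Omega>, \<Omega>') \<in> ext_equiv (field_alg :: ('k, 'k) alg) (*)" for \<Omega> \<Omega>'
    using that k_ext_equiv_iff by (metis (no_types, lifting) SigmaE2 case_prod_conv ext_structs_field_algE subsetD)
  have **: "(case_prod k_ext p, case_prod k_ext q) \<in> ext_equiv field_alg (*) \<longleftrightarrow> (p, q) \<in> pair_equiv"
    for p q :: "'k \<times> 'k"
    by (cases p; cases q) (simp add: k_ext_equiv_iff)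
  show "refl_on (ext_structs field_alg (*)) (ext_equiv (field_alg :: ('k, 'k) alg) (*))"
    using eq(1) by (auto intro!: refl_onI elim!: ext_structs_field_algE simp: k_ext_equiv_iff refl_on_def)
  show "sym (ext_equiv (field_alg :: ('k, 'k) alg) (*))"
    by (rule symI) (metis * ** eq(2) symD)
  show "trans (ext_equiv (field_alg :: ('k, 'k) alg) (*))"
    by (rule transI) (metis * ** eq(3) transD)
qed

section \<open>Systems of representatives\<close>

lemma two_eq_0_iff_CHAR: "(2 :: 'k::field) = 0 \<longleftrightarrow> CHAR('k) = 2"
proof -
  have "(2 :: 'k) = 0 \<longleftrightarrow> CHAR('k) dvd 2"
    using of_nat_eq_0_iff_char_dvd[of 2, where 'a = 'k] by simp
  moreover have "CHAR('k) \<noteq> 1" by simp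
  moreover have "n = 2" if "n dvd 2" "n \<noteq> 1" for n :: nat
    using that dvd_imp_le[OF that(1)] by (cases "n = 0") auto
  ultimately show ?thesis by (metis dvd_refl)
qed

text \<open>The number b^2 + 4 a is the discriminant of X^2 - b X - a: translation by \<alpha>
  leaves it unchanged and scaling by q multiplies it by q^2.\<close>

lemma pair_equiv_iff_discriminant:
  fixes a b a' b' :: "'k::field"
  assumes "CHAR('k) \<noteq> 2"
  shows "((a, b), (a', b')) \<in> pair_equiv \<longleftrightarrow> S_equiv (b\<^sup>2 + 4 * a) (b'\<^sup>2 + 4 * a')"
proof
  assume "((a, b), (a', b')) \<in> pair_equiv"
  then obtain q \<alpha> where q: "q \<noteq> 0" and a: "a = q\<^sup>2 * a' + \<alpha>\<^sup>2 - b * \<alpha>" and b: "b = q * b' + 2 * \<alpha>"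
    by (auto simp: pair_equiv_def)
  have "b\<^sup>2 + 4 * a = q\<^sup>2 * (b'\<^sup>2 + 4 * a')"
    by (simp add: a b power2_eq_square algebra_simps)
  then show "S_equiv (b\<^sup>2 + 4 * a) (b'\<^sup>2 + 4 * a')" using q by (auto simp: S_equiv_def)
next
  assume "S_equiv (b\<^sup>2 + 4 * a) (b'\<^sup>2 + 4 * a')"
  then obtain q where q: "q \<noteq> 0" and d: "b\<^sup>2 + 4 * a = q\<^sup>2 * (b'\<^sup>2 + 4 * a')"
    by (auto simp: S_equiv_def)
  have 2: "(2 :: 'k) \<noteq> 0" using assms by (simp add: two_eq_0_iff_CHAR)
  then have 4: "(4 :: 'k) \<noteq> 0" by (metis mult_2_right mult_eq_0_iff numeral_Bit0)
  \<comment> \<open>The second equation forces this value once q is given; the first then holds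
    after multiplication by 4, which can be cancelled.\<close>
  define \<alpha> where "\<alpha> = (b - q * b') / 2"
  have "2 * \<alpha> = b - q * b'"
    unfolding \<alpha>_def times_divide_eq_right using 2 by (rule nonzero_mult_div_cancel_left)
  then have b: "b = q * b' + 2 * \<alpha>" by simp
  have "4 * a = 4 * (q\<^sup>2 * a' + \<alpha>\<^sup>2 - b * \<alpha>)"
    using d unfolding b by (simp add: power2_eq_square algebra_simps)
  then have "a = q\<^sup>2 * a' + \<alpha>\<^sup>2 - b * \<alpha>" using mult_left_cancel[OF 4] by blast
  then show "((a, b), (a', b')) \<in> pair_equiv" using q b by (auto simp: pair_equiv_def)
qed

text \<open>In characteristic 2 the second equation reads b = q b', so vanishing of b is invariant.
  If b = b' = 0, the first equation is \<open>R_equiv\<close>. Otherwise q = b / b' is forced, and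
  division by b^2 turns the first equation into \<open>T_equiv\<close>.\<close>

lemma pair_equiv_char_2_iff:
  fixes a a' b b' :: "'k::field"
  assumes "CHAR('k) = 2"
  shows "((a, b), (a', 0)) \<in> pair_equiv \<longleftrightarrow> b = 0 \<and> R_equiv a a'"
    and "b' \<noteq> 0 \<Longrightarrow> ((a, b), (a', b')) \<in> pair_equiv \<longleftrightarrow> b \<noteq> 0 \<and> T_equiv (a / b\<^sup>2) (a' / b'\<^sup>2)"
proof -
  have 2: "(2 :: 'k) = 0" using assms by (simp add: two_eq_0_iff_CHAR)
  \<comment> \<open>The variable \<open>b'\<close> is generalized here so that the value 0 is
    covered as well.\<close>
  have *: "((a, b), (a', b')) \<in> pair_equiv \<longleftrightarrow>
      (\<exists>q \<alpha>. q \<noteq> 0 \<and> a - q\<^sup>2 * a' = \<alpha>\<^sup>2 - b * \<alpha> \<and> b = q * b')" for b'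
    by (auto simp: pair_equiv_def 2 algebra_simps)
  show "((a, b), (a', 0)) \<in> pair_equiv \<longleftrightarrow> b = 0 \<and> R_equiv a a'"
    by (auto simp: * R_equiv_def squares_def) blast+
  assume b': "b' \<noteq> 0"
  show "((a, b), (a', b')) \<in> pair_equiv \<longleftrightarrow> b \<noteq> 0 \<and> T_equiv (a / b\<^sup>2) (a' / b'\<^sup>2)"
  proof
    assume "((a, b), (a', b')) \<in> pair_equiv"
    then obtain q \<alpha> where q: "q \<noteq> 0" and "a - q\<^sup>2 * a' = \<alpha>\<^sup>2 - b * \<alpha>" and b: "b = q * b'"
      unfolding * by blast
    then have a: "a = q\<^sup>2 * a' + (\<alpha>\<^sup>2 - b * \<alpha>)" by (simp add: algebra_simps)
    have "a / b\<^sup>2 - a' / b'\<^sup>2 = (\<alpha> / b)\<^sup>2 - \<alpha> / b"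
      using q b' by (simp add: a b field_simps power2_eq_square)
    then show "b \<noteq> 0 \<and> T_equiv (a / b\<^sup>2) (a' / b'\<^sup>2)" using q b b' by (auto simp: T_equiv_def)
  next
    assume "b \<noteq> 0 \<and> T_equiv (a / b\<^sup>2) (a' / b'\<^sup>2)"
    then obtain \<alpha> where b: "b \<noteq> 0" and \<alpha>: "a / b\<^sup>2 - a' / b'\<^sup>2 = \<alpha>\<^sup>2 - \<alpha>" by (auto simp: T_equiv_def)
    \<comment> \<open>Clearing the denominator b^2 replaces \<alpha> by b \<alpha>, which together
      with q = b / b' is the witness below.\<close>
    have "a = b\<^sup>2 * (a / b\<^sup>2 - a' / b'\<^sup>2) + (b / b')\<^sup>2 * a'"
      using b by (simp add: right_diff_distrib power_divide)
    also have "\<dots> = (b / b')\<^sup>2 * a' + ((b * \<alpha>)\<^sup>2 - b * (b * \<alpha>))"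
      unfolding \<alpha> by (simp add: power2_eq_square algebra_simps)
    finally show "((a, b), (a', b')) \<in> pair_equiv"
      unfolding * using b b' by (intro exI[of _ "b / b'"] exI[of _ "b * \<alpha>"]) auto
  qed
qed

section \<open>Explicit representatives and the index of the squares\<close>

lemma squares_0 [simp]: "0 \<in> squares"
  by (auto simp: squares_def intro: exI[of _ 0])

lemma S_equiv_sym: "S_equiv d d' \<Longrightarrow> S_equiv d' d"
  unfolding S_equiv_def by (elim exE conjE, rule_tac x = "1 / q" in exI) (simp add: power_divide)

lemma S_equiv_trans: "S_equiv c d \<Longrightarrow> S_equiv d e \<Longrightarrow> S_equiv c e"
  unfolding S_equiv_def by (metis mult.assoc mult_eq_0_iff power_mult_distrib)

lemma S_equiv_0_iff [simp]: "S_equiv d 0 \<longleftrightarrow> d = 0"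
  by (auto simp: S_equiv_def intro: exI[of _ 1])

lemma S_equiv_1_iff: "S_equiv d 1 \<longleftrightarrow> d \<noteq> 0 \<and> d \<in> squares"
  by (auto simp: S_equiv_def squares_def)

text \<open>The discriminant D of a pair is zero, a nonzero square or a nonsquare; these cases
  select (0, 0), (0, 1) and exactly one (d, 0) with d in S.\<close>

lemma system_of_reps_char_neq_2:
  assumes char: "CHAR('k) \<noteq> 2"
    and S: "system_of_reps (UNIV - squares) S_equiv (S :: 'k::field set)"
  shows "system_of_reps UNIV (\<lambda>x y. (x, y) \<in> pair_equiv) ({(0, 0), (0, 1)} \<union> {(d, 0) | d. d \<in> S})"
  unfolding system_of_reps_def
proof (intro conjI ballI, goal_cases)
  case (2 x)
  obtain a b where x: "x = (a, b)" by (cases x)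
  define D where "D = b\<^sup>2 + 4 * a"
  have 2: "(2 :: 'k) \<noteq> 0" using char by (simp add: two_eq_0_iff_CHAR)
  \<comment> \<open>The pair (d, 0) has discriminant 4 d, and the factor 4 is the square of the
    nonzero element 2.\<close>
  have "S_equiv (4 * d) d" for d :: 'k
    using 2 unfolding S_equiv_def by (intro exI[of _ 2]) simp
  then have "S_equiv D (4 * d) \<longleftrightarrow> S_equiv D d" for d by (meson S_equiv_trans S_equiv_sym)
  then have iff: "(x, (0, 0)) \<in> pair_equiv \<longleftrightarrow> D = 0"
    "(x, (0, 1)) \<in> pair_equiv \<longleftrightarrow> D \<noteq> 0 \<and> D \<in> squares"
    "(x, (d, 0)) \<in> pair_equiv \<longleftrightarrow> S_equiv D d" for d
    by (simp_all add: x D_def pair_equiv_iff_discriminant[OF char] S_equiv_1_iff)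
  show ?case
  proof (cases "D \<in> squares")
    case True
    \<comment> \<open>A d equivalent to the square D would be a square itself.\<close>
    have "\<not> S_equiv D d" if "d \<in> S" for d
    proof
      assume "S_equiv D d"
      then obtain q where "q \<noteq> 0" "d = q\<^sup>2 * D" using S_equiv_sym S_equiv_def by blast
      then have "d \<in> squares" using True by (auto simp: squares_def simp flip: power_mult_distrib)
      then show False using that S by (auto simp: system_of_reps_def)
    qed
    then show ?thesis
      by (intro ex1I[of _ "(0, if D = 0 then 0 else 1)"]) (use True iff in \<open>auto split: if_splits\<close>)
  next
    case False
    obtain d where d: "d \<in> S" "S_equiv D d"
      and uniq: "\<And>d'. d' \<in> S \<Longrightarrow> S_equiv D d' \<Longrightarrow> d' = d"
      using S False unfolding system_of_reps_def by (metis DiffI UNIV_I)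
    have "D \<noteq> 0" using False squares_0 by metis
    then show ?thesis
      by (intro ex1I[of _ "(d, 0)"]) (use False d in \<open>auto simp: iff dest: uniq\<close>)
  qed
qed simp


text \<open>For nonzero b the representative is (c, 1) with c in T equivalent to a / b^2. For b = 0
  it is (0, 0) if a is a square, and otherwise (d, 0) with d in R equivalent to a.\<close>

lemma system_of_reps_char_2:
  assumes char: "CHAR('k) = 2"
    and R: "system_of_reps (UNIV - squares) R_equiv (R :: 'k::field set)"
    and T: "system_of_reps UNIV T_equiv (T :: 'k set)"
  shows "system_of_reps UNIV (\<lambda>x y. (x, y) \<in> pair_equiv)
    ({(0, 0)} \<union> {(c, 1) | c. c \<in> T} \<union> {(d, 0) | d. d \<in> R})"
  unfolding system_of_reps_def
proof (intro conjI ballI, goal_cases)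
  case (2 x)
  obtain a b where x: "x = (a, b)" by (cases x)
  show ?case
  proof (cases "b = 0")
    case False
    obtain c where c: "c \<in> T" "T_equiv (a / b\<^sup>2) c"
      and uniq: "\<And>c'. c' \<in> T \<Longrightarrow> T_equiv (a / b\<^sup>2) c' \<Longrightarrow> c' = c"
      using T unfolding system_of_reps_def by (metis UNIV_I)
    show ?thesis
      by (rule ex1I[of _ "(c, 1)"])
        (use False c in \<open>auto simp: x pair_equiv_char_2_iff[OF char] dest: uniq\<close>)
  next
    case b: True
    have sq: "R_equiv a 0 \<longleftrightarrow> a \<in> squares"
      by (auto simp: R_equiv_def intro: exI[of _ 1])
    show ?thesis
    proof (cases "a \<in> squares")
      case True
      then obtain s where a: "a = s\<^sup>2" by (auto simp: squares_def)
      \<comment> \<open>Squaring is additive in characteristic 2: q^2 d is a difference of squares,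
        hence a square, and so d would be one.\<close>
      have "\<not> R_equiv a d" if "d \<in> R" for d
      proof
        assume "R_equiv a d"
        then obtain q t where q: "q \<noteq> 0" and "s\<^sup>2 - q\<^sup>2 * d = t\<^sup>2"
          by (auto simp: R_equiv_def squares_def a)
        moreover have "(s - t)\<^sup>2 = s\<^sup>2 - t\<^sup>2"
          using char by (simp add: power2_diff two_eq_0_iff_CHAR[symmetric])
        ultimately have "q\<^sup>2 * d = (s - t)\<^sup>2" by (simp add: algebra_simps)
        then have "d = ((s - t) / q)\<^sup>2" using q by (simp add: power_divide field_simps)
        then show False using that R by (auto simp: system_of_reps_def squares_def)
      qed
      then show ?thesis
        by (intro ex1I[of _ "(0, 0)"])
          (use b True sq in \<open>auto simp: x pair_equiv_char_2_iff[OF char]\<close>)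
    next
      case False
      obtain d where d: "d \<in> R" "R_equiv a d"
        and uniq: "\<And>d'. d' \<in> R \<Longrightarrow> R_equiv a d' \<Longrightarrow> d' = d"
        using R False unfolding system_of_reps_def by (metis DiffI UNIV_I)
      show ?thesis
        by (rule ex1I[of _ "(d, 0)"])
          (use b False d sq in \<open>auto simp: x pair_equiv_char_2_iff[OF char] dest: uniq\<close>)
    qed
  qed
qed simp

text \<open>The cosets of the nonzero squares are the classes of \<open>S_equiv\<close> on nonzero
  elements. The nonzero squares form the class of 1, and S represents all other classes.\<close>

lemma square_cosets_eqpoll:
  assumes S: "system_of_reps (UNIV - squares) S_equiv (S :: 'k::field set)"
  shows "(square_cosets :: 'k set set) \<approx> insert 1 S"
proof -
  define e where "e = {(x, y :: 'k). x \<noteq> 0 \<and> y \<noteq> 0 \<and> S_equiv x y}"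
  have refl: "S_equiv x x" for x :: 'k by (auto simp: S_equiv_def intro: exI[of _ 1])
  have e: "equiv (UNIV - {0}) e"
    by (auto simp: e_def refl intro!: equivI refl_onI symI transI intro: S_equiv_sym S_equiv_trans)
  have S0: "d \<noteq> 0" "\<not> S_equiv d 1" if "d \<in> S" for d
    using that S squares_0 by (auto simp: system_of_reps_def S_equiv_1_iff)
  have "system_of_reps (UNIV - {0}) (\<lambda>x y. (x, y) \<in> e) (insert 1 S)"
    unfolding system_of_reps_def
  proof (intro conjI ballI, goal_cases)
    case (2 x)
    show ?case
    proof (cases "x \<in> squares")
      case True
      then have "S_equiv x 1" using 2 by (simp add: S_equiv_1_iff)
      moreover then have "\<not> S_equiv x d" if "d \<in> S" for d
        using S0[OF that] S_equiv_sym S_equiv_trans by blast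
      ultimately show ?thesis using 2 by (intro ex1I[of _ 1]) (auto simp: e_def)
    next
      case False
      then obtain d where d: "d \<in> S" "S_equiv x d"
        and uniq: "\<And>d'. d' \<in> S \<Longrightarrow> S_equiv x d' \<Longrightarrow> d' = d"
        using S unfolding system_of_reps_def by (metis DiffI UNIV_I)
      show ?thesis using d 2 S0 False by (intro ex1I[of _ d]) (auto simp: e_def S_equiv_1_iff dest: uniq)
    qed
  qed (use S0 in auto)
  then have "insert 1 S \<approx> (UNIV - {0}) // e"
    using system_of_reps_bij_betw_quotient[OF e] by (auto simp: eqpoll_def)
  moreover have "e `` {a} = (squares - {0}) #>\<^bsub>mult_group\<^esub> a" if "a \<noteq> 0" for a
  proof -
    \<comment> \<open>Symmetry moves the square factor from y to a, which gives the shape of a right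
      coset.\<close>
    have "y \<in> e `` {a} \<longleftrightarrow> (\<exists>q. q \<noteq> 0 \<and> y = q\<^sup>2 * a)" for y
      using that S_equiv_sym[of a y] S_equiv_sym[of y a] by (auto simp: e_def S_equiv_def)
    then have "e `` {a} = {q\<^sup>2 * a | q. q \<noteq> 0}" by blast
    moreover have "squares - {0} = {q\<^sup>2 | q :: 'k. q \<noteq> 0}" by (auto simp: squares_def)
    ultimately show ?thesis by (auto simp: r_coset_def mult_group_def)
  qed
  then have "(UNIV - {0}) // e = square_cosets"
    by (auto simp: quotient_def square_cosets_def RCOSETS_def mult_group_def)
  ultimately show ?thesis using eqpoll_sym by simp
qed

section \<open>Transfer from pairs to isomorphism types and extending structures\<close>

lemma bij_betw_pair_classes_iso_types:
  "\<exists>F. bij_betw F (pair_classes :: ('k::field \<times> 'k) set set) iso_types \<and>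
    (\<forall>a b. F (pair_class a b) = iso_type (k_alg a b))"
proof -
  let ?f = "case_prod k_alg :: 'k \<times> 'k \<Rightarrow> ('k, 'k \<times> 'k) alg"
  have "?f x \<in> two_dim_algs" for x by (cases x) (simp add: k_alg_two_dim)
  moreover have "(?f x, ?f y) \<in> alg_iso_rel \<longleftrightarrow> (x, y) \<in> pair_equiv" for x y
    by (cases x; cases y) (simp add: alg_iso_rel_def k_alg_isomorphic_iff k_alg_two_dim)
  moreover have "\<exists>x\<in>UNIV. (A, ?f x) \<in> alg_iso_rel" if A: "A \<in> two_dim_algs" for A
  proof -
    obtain a b where "A \<cong>\<^sub>a k_alg a b" using two_dim_alg_isomorphic_k_alg[OF A] by blast
    then have "(A, ?f (a, b)) \<in> alg_iso_rel" using A by (simp add: alg_iso_rel_def k_alg_two_dim)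
    then show ?thesis by blast
  qed
  ultimately have "\<exists>F. bij_betw F (UNIV // pair_equiv) (two_dim_algs // alg_iso_rel) \<and>
      (\<forall>x\<in>UNIV. F (pair_equiv `` {x}) = alg_iso_rel `` {?f x})"
    by (intro bij_betw_quotients[OF equiv_pair_equiv equiv_alg_iso_rel])
  then show ?thesis
    by (simp add: pair_classes_def iso_types_def pair_class_def iso_type_def split_paired_All)
qed

lemma bij_betw_AH2_pair_classes:
  "\<exists>G. bij_betw G (AH2 (field_alg :: ('k, 'k) alg) (*)) (pair_classes :: ('k::field \<times> 'k) set set)"
proof -
  let ?f = "case_prod k_ext :: 'k \<times> 'k \<Rightarrow> ('k, 'k) ext_struct"
  let ?X = "ext_structs (field_alg :: ('k, 'k) alg) (*)"
  let ?E = "ext_equiv (field_alg :: ('k, 'k) alg) (*)"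
  have "?f x \<in> ?X" for x by (cases x) (simp add: k_ext_in_ext_structs)
  moreover have "(?f x, ?f y) \<in> ?E \<longleftrightarrow> (x, y) \<in> pair_equiv" for x y
    by (cases x; cases y) (simp add: k_ext_equiv_iff)
  moreover have "\<exists>x\<in>UNIV. (\<Omega>, ?f x) \<in> ?E" if \<Omega>: "\<Omega> \<in> ?X" for \<Omega>
  proof -
    obtain a b where "\<Omega> = ?f (a, b)" using \<Omega> by (auto elim: ext_structs_field_algE)
    moreover have "(\<Omega>, \<Omega>) \<in> ?E" using eq_equiv_class_iff[OF equiv_ext_equiv_field_alg \<Omega> \<Omega>] by simp
    ultimately show ?thesis by (intro bexI[of _ "(a, b)"]) simp_all
  qed
  ultimately have "\<exists>F. bij_betw F (UNIV // pair_equiv) (?X // ?E) \<and>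
      (\<forall>x\<in>UNIV. F (pair_equiv `` {x}) = ?E `` {?f x})"
    by (intro bij_betw_quotients[OF equiv_pair_equiv equiv_ext_equiv_field_alg])
  then obtain F where "bij_betw F ((UNIV :: ('k \<times> 'k) set) // pair_equiv) (?X // ?E)" by blast
  \<comment> \<open>The constructed bijection starts at the pairs, so its inverse is the one
    required.\<close>
  then show ?thesis unfolding pair_classes_def AH2_def by (rule bij_betw_inv)
qed

text \<open>The bijection between pair classes and isomorphism types carries any system of
  representatives along, so one argument serves all four cases of the classification.\<close>

lemma classification_by_reps:
  fixes P :: "('k::field \<times> 'k) set"
  assumes P: "system_of_reps UNIV (\<lambda>x y. (x, y) \<in> pair_equiv) P"
  shows "(pair_classes :: ('k \<times> 'k) set set) = (\<lambda>(a, b). pair_class a b) ` P"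
    and "(iso_types :: ('k, 'k \<times> 'k) alg set set) = (\<lambda>(a, b). iso_type (k_alg a b)) ` P"
    and "inj_on (\<lambda>(a, b). iso_type (k_alg a b)) P"
    and "(iso_types :: ('k, 'k \<times> 'k) alg set set) \<approx> P"
proof -
  have 1: "bij_betw (\<lambda>(a, b). pair_class a b) P (pair_classes :: ('k \<times> 'k) set set)"
    using system_of_reps_bij_betw_quotient[OF equiv_pair_equiv P]
    by (simp add: pair_classes_def pair_class_def case_prod_beta')
  obtain F where "bij_betw F (pair_classes :: ('k \<times> 'k) set set) iso_types"
    "\<And>a b. F (pair_class a b) = iso_type (k_alg a b)"
    using bij_betw_pair_classes_iso_types by blast
  then have 2: "bij_betw (\<lambda>(a, b). iso_type (k_alg a b)) P (iso_types :: ('k, 'k \<times> 'k) alg set set)"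
    using bij_betw_trans[OF 1] by (fastforce simp: comp_def case_prod_beta')
  show "(pair_classes :: ('k \<times> 'k) set set) = (\<lambda>(a, b). pair_class a b) ` P"
    using 1 by (simp add: bij_betw_def)
  show "(iso_types :: ('k, 'k \<times> 'k) alg set set) = (\<lambda>(a, b). iso_type (k_alg a b)) ` P"
    "inj_on (\<lambda>(a, b). iso_type (k_alg a b)) P"
    using 2 by (simp_all add: bij_betw_def)
  show "(iso_types :: ('k, 'k \<times> 'k) alg set set) \<approx> P"
    unfolding eqpoll_def using bij_betw_inv_into[OF 2] by blast
qed

text \<open>Here x is idempotent; sending 1 to (1, 1) and x to the idempotent (0, 1) splits the
  algebra.\<close>

lemma k_alg_0_1_isomorphic_prod_alg: "k_alg 0 1 \<cong>\<^sub>a (prod_alg :: ('k::field, 'k \<times> 'k) alg)"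
proof -
  define \<phi> :: "'k \<times> 'k \<Rightarrow> 'k \<times> 'k" where "\<phi> p = (fst p, fst p + snd p)" for p
  have "bij \<phi>"
    by (rule bij_betw_byWitness[where f' = "\<lambda>p. (fst p, snd p - fst p)"]) (auto simp: \<phi>_def)
  moreover have "Vector_Spaces.linear pair_scale pair_scale \<phi>"
    unfolding Vector_Spaces.linear_iff
    by (simp add: vector_space_pair_scale \<phi>_def) (simp add: pair_scale_def algebra_simps)
  ultimately have "alg_iso (k_alg 0 1) prod_alg \<phi>"
    by (auto simp: alg_iso_def k_alg_def prod_alg_def \<phi>_def algebra_simps)
  then show ?thesis by (auto simp: isomorphic_def)
qed

section \<open>Counting the representatives\<close>

lemma reps_char_neq_2_eqpoll:
  fixes S :: "'k::field set"
  assumes S: "system_of_reps (UNIV - squares) S_equiv S"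
  shows "{(0 :: 'k, 0 :: 'k), (0, 1)} \<union> {(d, 0) | d. d \<in> S} \<approx> {()} <+> (square_cosets :: 'k set set)"
proof -
  have "1 \<in> (squares :: 'k set)" by (auto simp: squares_def intro: exI[of _ 1])
  \<comment> \<open>Both 0 and 1 are squares, whereas S consists of nonsquares.\<close>
  then have S': "0 \<notin> S" "1 \<notin> S" using S by (auto simp: system_of_reps_def)
  \<comment> \<open>The pair (0, 1) corresponds to the trivial coset, represented by 1; as 1 is not
    in S, the case distinction never touches a pair (d, 0).\<close>
  define h :: "unit + 'k \<Rightarrow> 'k \<times> 'k"
    where "h = case_sum (\<lambda>_. (0, 0)) (\<lambda>d. if d = 1 then (0, 1) else (d, 0))"
  have h: "bij_betw h ({()} <+> insert 1 S) ({(0, 0), (0, 1)} \<union> {(d, 0) | d. d \<in> S})"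
  proof (rule bij_betw_imageI)
    show "inj_on h ({()} <+> insert 1 S)"
      using S' by (auto simp: inj_on_def h_def split: if_splits)
    have "h ` ({()} <+> insert 1 S) = {(0, 0), (0, 1)} \<union> (\<lambda>d. h (Inr d)) ` S"
      by (auto simp: Plus_def image_Un image_image h_def)
    also have "(\<lambda>d. h (Inr d)) ` S = {(d, 0) | d. d \<in> S}"
      using S' by (auto simp: h_def image_iff)
    finally show "h ` ({()} <+> insert 1 S) = {(0, 0), (0, 1)} \<union> {(d, 0) | d. d \<in> S}" .
  qed
  have "{(0 :: 'k, 0 :: 'k), (0, 1)} \<union> {(d, 0) | d. d \<in> S} \<approx> {()} <+> insert 1 S"
    unfolding eqpoll_def using bij_betw_inv_into[OF h] by blast
  also have "\<dots> \<approx> {()} <+> (square_cosets :: 'k set set)"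
    using square_cosets_eqpoll[OF S] by (intro sum_eqpoll_cong) (auto intro: eqpoll_sym)
  finally show ?thesis .
qed

text \<open>The second coordinate separates the pairs coming from T from the others, and (0, 0)
  differs from every (d, 0) because R omits the square 0.\<close>

lemma reps_char_2_eqpoll:
  fixes R T :: "'k::field set"
  assumes R: "system_of_reps (UNIV - squares) R_equiv R"
  shows "{(0 :: 'k, 0 :: 'k)} \<union> {(c, 1) | c. c \<in> T} \<union> {(d, 0) | d. d \<in> R} \<approx> {()} <+> (T <+> R)"
proof -
  have R0: "0 \<notin> R" using R squares_0 by (auto simp: system_of_reps_def)
  define h :: "unit + 'k + 'k \<Rightarrow> 'k \<times> 'k"
    where "h = case_sum (\<lambda>_. (0, 0)) (case_sum (\<lambda>c. (c, 1)) (\<lambda>d. (d, 0)))"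
  have h: "bij_betw h ({()} <+> (T <+> R)) ({(0, 0)} \<union> {(c, 1) | c. c \<in> T} \<union> {(d, 0) | d. d \<in> R})"
  proof (rule bij_betw_imageI)
    show "inj_on h ({()} <+> (T <+> R))"
      using R0 by (auto simp: inj_on_def h_def)
    show "h ` ({()} <+> (T <+> R)) = {(0, 0)} \<union> {(c, 1) | c. c \<in> T} \<union> {(d, 0) | d. d \<in> R}"
      by (auto simp: Plus_def image_Un image_image h_def)
  qed
  show ?thesis unfolding eqpoll_def using bij_betw_inv_into[OF h] by blast
qed

text \<open>Except for the case with exactly two types, counts are equipollences with disjoint sums,
  since the index and the sets T and R may be infinite. Isomorphism types live on
  \<open>'k \<times> 'k\<close>; the last conjunct of the first part links algebras on another
  carrier type \<open>'a\<close> to them.\<close>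

theorem corollary3p6:
  fixes S R T :: "'k::field set"
  assumes S: "(squares :: 'k set) \<noteq> UNIV \<Longrightarrow> system_of_reps (UNIV - squares) S_equiv S"
    and R: "CHAR('k) = 2 \<Longrightarrow> (squares :: 'k set) \<noteq> UNIV \<Longrightarrow>
              system_of_reps (UNIV - squares) R_equiv R"
    and T: "CHAR('k) = 2 \<Longrightarrow> system_of_reps UNIV T_equiv T \<and> 0 \<in> T"
  shows
    "( equiv UNIV (pair_equiv :: (('k \<times> 'k) \<times> ('k \<times> 'k)) set) \<and>
       (\<exists>G. bij_betw G (AH2 (field_alg :: ('k, 'k) alg) (*)) (pair_classes :: ('k \<times> 'k) set set)) \<and>
       (\<exists>F. bij_betw F (pair_classes :: ('k \<times> 'k) set set) iso_types \<and>
            (\<forall>a b. F (pair_class a b) = iso_type (k_alg a b))) \<and>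
       (\<forall>A \<in> (two_dim_algs :: ('k, 'a::ab_group_add) alg set). \<exists>a b. A \<cong>\<^sub>a k_alg a b) )
     \<and>
     ( CHAR('k) \<noteq> 2 \<and> (squares :: 'k set) = UNIV \<longrightarrow>
         (pair_classes :: ('k \<times> 'k) set set) = {pair_class 0 0, pair_class 0 1} \<and>
         (iso_types :: ('k, 'k \<times> 'k) alg set set) = {iso_type (k_alg 0 0), iso_type (k_alg 0 1)} \<and>
         card (iso_types :: ('k, 'k \<times> 'k) alg set set) = 2 \<and>
         (k_alg 0 1 :: ('k, 'k \<times> 'k) alg) \<cong>\<^sub>a (prod_alg :: ('k, 'k \<times> 'k) alg) )
     \<and>
     ( CHAR('k) \<noteq> 2 \<and> (squares :: 'k set) \<noteq> UNIV \<longrightarrow>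
         (pair_classes :: ('k \<times> 'k) set set) =
           {pair_class 0 0, pair_class 0 1} \<union> {pair_class d 0 | d. d \<in> S} \<and>
         (iso_types :: ('k, 'k \<times> 'k) alg set set) =
           {iso_type (k_alg 0 0), iso_type (k_alg 0 1)} \<union> {iso_type (k_alg d 0) | d. d \<in> S} \<and>
         inj_on (\<lambda>(a, b). iso_type (k_alg a b)) ({(0, 0), (0, 1)} \<union> {(d, 0) | d. d \<in> S}) \<and>
         (iso_types :: ('k, 'k \<times> 'k) alg set set) \<approx> {()} <+> (square_cosets :: 'k set set) )
     \<and>
     ( CHAR('k) = 2 \<and> (squares :: 'k set) = UNIV \<longrightarrow>
         (pair_classes :: ('k \<times> 'k) set set) =
           {pair_class 0 0} \<union> {pair_class c 1 | c. c \<in> T} \<and>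
         (iso_types :: ('k, 'k \<times> 'k) alg set set) =
           {iso_type (k_alg 0 0)} \<union> {iso_type (k_alg c 1) | c. c \<in> T} \<and>
         inj_on (\<lambda>(a, b). iso_type (k_alg a b)) ({(0, 0)} \<union> {(c, 1) | c. c \<in> T}) \<and>
         (iso_types :: ('k, 'k \<times> 'k) alg set set) \<approx> {()} <+> T )
     \<and>
     ( CHAR('k) = 2 \<and> (squares :: 'k set) \<noteq> UNIV \<longrightarrow>
         (pair_classes :: ('k \<times> 'k) set set) =
           {pair_class 0 0} \<union> {pair_class c 1 | c. c \<in> T} \<union> {pair_class \<delta> 0 | \<delta>. \<delta> \<in> R} \<and>
         (iso_types :: ('k, 'k \<times> 'k) alg set set) =
           {iso_type (k_alg 0 0)} \<union> {iso_type (k_alg c 1) | c. c \<in> T}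
             \<union> {iso_type (k_alg \<delta> 0) | \<delta>. \<delta> \<in> R} \<and>
         inj_on (\<lambda>(a, b). iso_type (k_alg a b))
           ({(0, 0)} \<union> {(c, 1) | c. c \<in> T} \<union> {(\<delta>, 0) | \<delta>. \<delta> \<in> R}) \<and>
         (iso_types :: ('k, 'k \<times> 'k) alg set set) \<approx> {()} <+> (T <+> R) )"
proof -
  \<comment> \<open>If every element is a square, there is no nonsquare to represent; taking S or R
    empty reduces these cases to the general lemmas.\<close>
  have empty: "system_of_reps (UNIV - squares) E ({} :: 'k set)" if "squares = (UNIV :: 'k set)" for E
    using that by (simp add: system_of_reps_def)
  note neq_2 = classification_by_reps[OF system_of_reps_char_neq_2[where 'k = 'k]]
    and eq_2 = classification_by_reps[OF system_of_reps_char_2[where 'k = 'k]]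
    and image_simps = Setcompr_eq_image image_Un image_image
  show ?thesis
  proof (intro conjI impI, goal_cases)
    case 1
    show ?case by (rule equiv_pair_equiv)
  next
    case 2
    show ?case by (rule bij_betw_AH2_pair_classes)
  next
    case 3
    show ?case by (rule bij_betw_pair_classes_iso_types)
  next
    case 4
    show ?case using two_dim_alg_isomorphic_k_alg by blast
  next
    case 5
    then show ?case using neq_2(1)[OF _ empty] by simp
  next
    case 6
    then show ?case using neq_2(2)[OF _ empty] by simp
  next
    case 7
    then show ?case using neq_2(2)[OF _ empty] card_image[OF neq_2(3)[OF _ empty]] by simp
  next
    case 8
    show ?case by (rule k_alg_0_1_isomorphic_prod_alg)
  next
    case 9
    then show ?case using neq_2(1)[OF _ S] by (simp add: image_simps)
  next
    case 10
    then show ?case using neq_2(2)[OF _ S] by (simp add: image_simps)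
  next
    case 11
    then show ?case using neq_2(3)[OF _ S] by blast
  next
    case 12
    then show ?case using neq_2(4)[OF _ S] reps_char_neq_2_eqpoll[OF S] eqpoll_trans by blast
  next
    case 13
    then show ?case using eq_2(1)[OF _ empty, of T] T by (simp add: image_simps)
  next
    case 14
    then show ?case using eq_2(2)[OF _ empty, of T] T by (simp add: image_simps)
  next
    case 15
    then show ?case using eq_2(3)[OF _ empty, of T] T by simp
  next
    case 16
    have "(iso_types :: ('k, 'k \<times> 'k) alg set set) \<approx> {()} <+> (T <+> ({} :: 'k set))"
      using 16 eq_2(4)[OF _ empty, of T] T reps_char_2_eqpoll[OF empty] eqpoll_trans by blast
    moreover have "bij_betw Inl T (T <+> ({} :: 'k set))" by (auto simp: bij_betw_def Plus_def)
    then have "T <+> ({} :: 'k set) \<approx> T" by (intro eqpoll_sym[of T]) (unfold eqpoll_def, blast)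
    ultimately show ?case
      using eqpoll_trans sum_eqpoll_cong[OF eqpoll_refl] by blast
  next
    case 17
    then show ?case using eq_2(1)[OF _ R, of T] T by (simp add: image_simps)
  next
    case 18
    then show ?case using eq_2(2)[OF _ R, of T] T by (simp add: image_simps)
  next
    case 19
    then show ?case using eq_2(3)[OF _ R, of T] T by blast
  next
    case 20
    then show ?case using eq_2(4)[OF _ R, of T] T reps_char_2_eqpoll[OF R, of T] eqpoll_trans by blast
  qed
qed

end
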